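(* The two measure-dimension mappings $\dim_C$ and $\dim_{MC}$ on $\mathcal{M}(X)$ are in general neither upper semi-continuous nor lower semi-continuous under the total variation topology. That is, for each $D\in\{\dim_C,\dim_{MC}\}$ there is a metric space $X$ for which $D$ is not upper semi-continuous, and there is a metric space $X$ for which $D$ is not lower semi-continuous, on (its domain of definition in) $\mathcal{M}(X)$ with respect to the total variation topology.
   Context: $\mathcal{M}(X)$ is the set of Borel probability measures on the metric space $X$, $\mathscr{A}$ the Borel $\sigma$-algebra, $B(x,r)$ the closed ball. Define, when the limits exist, $$\dim_C\nu=\lim_{r\to0}\frac{\log\int\nu(B(x,r))\,d\nu(x)}{\log r},\qquad \dim_{MC}\nu=\lim_{\delta\to0}\ \sup_{\{A\in\mathscr{A}:\,\nu(A)\ge1-\delta\}}\ \lim_{r\to0}\frac{\log\int_A\nu(B(x,r))\,d\nu(x)}{\log r}.$$ The total variation topology is induced by the metric $\|\nu-\varrho\|_{TV}=\sup_{A\in\mathscr{A}}|\nu(A)-\varrho(A)|$. A mapping $D$ is upper (lower) semi-continuous if $\nu_n\to\nu$ implies $\limsup_n D(\nu_n)\le D(\nu)$ (respectively $\liminf_n D(\nu_n)\ge D(\nu)$). *)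

theory Defs
  imports "HOL-Probability.Probability"
begin

definition borel_of_metric :: "'a metric \<Rightarrow> 'a measure" where
  "borel_of_metric X = sigma (mspace X) {U. openin (mtopology_of X) U}"

definition borel_probs :: "'a metric \<Rightarrow> 'a measure set" where
  "borel_probs X = {\<nu>. sets \<nu> = sets (borel_of_metric X) \<and> prob_space \<nu>}"

(* The quotient log(integral over A of nu(B(x,r)) d nu(x)) / log r.  It is extended-real valued:
   log 0 = -infinity, so for 0 < r < 1 a vanishing integral gives the value +infinity
   (Isabelle's convention ln 0 = 0 would give 0 instead). *)
definition corr_quotient :: "'a metric \<Rightarrow> 'a measure \<Rightarrow> 'a set \<Rightarrow> real \<Rightarrow> ereal" where
  "corr_quotient X \<nu> A r =
     (let I = (LINT x:A|\<nu>. measure \<nu> (mcball_of X x r))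
      in if I = 0 then \<infinity> else ereal (ln I / ln r))"

definition corr_limit_exists :: "'a metric \<Rightarrow> 'a measure \<Rightarrow> 'a set \<Rightarrow> bool" where
  "corr_limit_exists X \<nu> A \<longleftrightarrow> (\<exists>l. (corr_quotient X \<nu> A \<longlongrightarrow> l) (at_right 0))"

definition corr_limit :: "'a metric \<Rightarrow> 'a measure \<Rightarrow> 'a set \<Rightarrow> ereal" where
  "corr_limit X \<nu> A = Lim (at_right 0) (corr_quotient X \<nu> A)"

definition dim_C :: "'a metric \<Rightarrow> 'a measure \<Rightarrow> ereal" where
  "dim_C X \<nu> = corr_limit X \<nu> (mspace X)"

definition dim_C_domain :: "'a metric \<Rightarrow> 'a measure set" where
  "dim_C_domain X = {\<nu> \<in> borel_probs X. corr_limit_exists X \<nu> (mspace X)}"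

(* The inner limit need not exist for every A; the supremum is taken over those Borel sets A
   with nu(A) >= 1 - delta for which it does. *)
definition MC_sets :: "'a metric \<Rightarrow> 'a measure \<Rightarrow> real \<Rightarrow> 'a set set" where
  "MC_sets X \<nu> \<delta> =
     {A \<in> sets (borel_of_metric X). measure \<nu> A \<ge> 1 - \<delta> \<and> corr_limit_exists X \<nu> A}"

definition dim_MC :: "'a metric \<Rightarrow> 'a measure \<Rightarrow> ereal" where
  "dim_MC X \<nu> = Lim (at_right 0) (\<lambda>\<delta>::real. SUP A\<in>MC_sets X \<nu> \<delta>. corr_limit X \<nu> A)"

(* dim_MC is defined when, for every delta > 0, the supremum ranges over a nonempty family.
   The outer limit then exists automatically in the extended reals, because the supremum is
   monotone in delta. *)
definition dim_MC_domain :: "'a metric \<Rightarrow> 'a measure set" where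
  "dim_MC_domain X = {\<nu> \<in> borel_probs X. \<forall>\<delta>>0. MC_sets X \<nu> \<delta> \<noteq> {}}"

definition tv_dist :: "'a metric \<Rightarrow> 'a measure \<Rightarrow> 'a measure \<Rightarrow> real" where
  "tv_dist X \<nu> \<rho> = (SUP A\<in>sets (borel_of_metric X). \<bar>measure \<nu> A - measure \<rho> A\<bar>)"

(* Semi-continuity of D on its domain P.  The total variation topology is metrizable, so
   convergence is expressed by the metric. *)
definition tv_upper_semicontinuous ::
    "'a metric \<Rightarrow> 'a measure set \<Rightarrow> ('a measure \<Rightarrow> ereal) \<Rightarrow> bool" where
  "tv_upper_semicontinuous X P D \<longleftrightarrow>
     (\<forall>\<nu>s \<nu>. (\<forall>n::nat. \<nu>s n \<in> P) \<longrightarrow> \<nu> \<in> P \<longrightarrow> (\<lambda>n. tv_dist X (\<nu>s n) \<nu>) \<longlonglongrightarrow> 0 \<longrightarrow>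
        limsup (\<lambda>n. D (\<nu>s n)) \<le> D \<nu>)"

definition tv_lower_semicontinuous ::
    "'a metric \<Rightarrow> 'a measure set \<Rightarrow> ('a measure \<Rightarrow> ereal) \<Rightarrow> bool" where
  "tv_lower_semicontinuous X P D \<longleftrightarrow>
     (\<forall>\<nu>s \<nu>. (\<forall>n::nat. \<nu>s n \<in> P) \<longrightarrow> \<nu> \<in> P \<longrightarrow> (\<lambda>n. tv_dist X (\<nu>s n) \<nu>) \<longlonglongrightarrow> 0 \<longrightarrow>
        D \<nu> \<le> liminf (\<lambda>n. D (\<nu>s n)))"

end

theory Submission
  imports Defs "HOL-Real_Asymp.Real_Asymp"
begin

text \<open>
One metric on the real line serves for all four claims: the negative half-line is Euclidean, the
nonnegative half-line carries the ultrametric of nested partitions into cells whose lengths are so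
sparse that each is the fourth power of the one before, and the two are far apart.

Lower semi-continuity fails because of an atom. Lebesgue measure on \<open>{-1..<0}\<close> has dimension 1 in
both senses (\<open>truncated 0\<close>). Adding an atom of small mass moves it little in total variation, but
any set of nearly full measure must contain the atom, and then the correlation integral does not
tend to 0, so both dimensions become 0 (\<open>with_atom\<close>).

Upper semi-continuity needs a measure of dimension 0 whose low dimension can be removed by taking
away little mass. The measure \<open>spiked\<close> lives on the ultrametric half-line and has a density with a
peak at 0 so sharp that the correlation integral decays only logarithmically. Cutting off the peak
and placing the removed mass on the Euclidean half-line gives the measures \<open>truncated n\<close>, which
have bounded density and a correlation integral of exact order \<open>r\<close>, hence dimension 1. Both
kinds of measures are geometric mixtures that agree in finitely many components, and this gives
the convergence (\<open>tv_dist_mixture_splice\<close>).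

For \<^const>\<open>dim_C\<close> this suffices. For \<^const>\<open>dim_MC\<close> the difficulty is that the supremum also runs
over sets that avoid the peak, and on these the correlation integral is small. This is where the
sparse distances enter. On the ultrametric half-line balls are constant for radii between
consecutive distances, so for every set \<open>A\<close> the correlation integral is a step function of
\<open>r\<close> with steps that are long on a logarithmic scale. The quotient of logarithms changes by a
factor 2 within one step, so it can only converge to 0 or \<open>\<infinity>\<close>, and \<open>\<infinity>\<close> is excluded by a power lower
bound. Sets that avoid the peak therefore have no exponent and drop out of the supremum
(\<open>corr_quotient_spiked_pinned\<close>). In \<open>truncated n\<close> the mass on the Euclidean half-line makes the
exponent exist: it contributes a multiple of \<open>r\<close> at every small radius, and the bounded density gives an
upper bound of the same order.
\<close>

section \<open>Correlation integrals and their exponents\<close>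

definition corr_integral :: "'a metric \<Rightarrow> 'a measure \<Rightarrow> 'a set \<Rightarrow> real \<Rightarrow> real" where
  "corr_integral X \<nu> A r = (LINT x:A|\<nu>. measure \<nu> (mcball_of X x r))"

lemma corr_quotient_eq:
  "corr_quotient X \<nu> A r =
     (if corr_integral X \<nu> A r = 0 then \<infinity> else ereal (ln (corr_integral X \<nu> A r) / ln r))"
  by (simp add: corr_quotient_def corr_integral_def Let_def)

text \<open>
The exponent sees the correlation integral only up to factors whose logarithm is small compared to
\<open>ln r\<close>, so bounds of the same exponent, even far apart, determine it. Positivity of the lower bound keeps the quotient away
from its value \<open>\<infinity>\<close>.
\<close>

lemma corr_quotient_tendsto:
  fixes X :: "'a metric"
  assumes "\<forall>\<^sub>F r in at_right 0.
      0 < lo r \<and> lo r \<le> corr_integral X \<nu> A r \<and> corr_integral X \<nu> A r \<le> hi r"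
    and lo: "((\<lambda>r. ln (lo r) / ln r) \<longlongrightarrow> l) (at_right 0)"
    and hi: "((\<lambda>r. ln (hi r) / ln r) \<longlongrightarrow> l) (at_right 0)"
  shows "(corr_quotient X \<nu> A \<longlongrightarrow> ereal l) (at_right 0)"
proof -
  let ?q = "\<lambda>r. ln (corr_integral X \<nu> A r) / ln r"
  have small: "\<forall>\<^sub>F r in at_right 0. 0 < r \<and> r < (1::real)"
    using eventually_at_right_real[of 0 1] by simp
  have "(?q \<longlongrightarrow> l) (at_right 0)"
  proof (rule tendsto_sandwich[OF _ _ hi lo])
    show "\<forall>\<^sub>F r in at_right 0. ln (hi r) / ln r \<le> ?q r"
      using assms(1) small by eventually_elim (auto intro!: divide_right_mono_neg)
    show "\<forall>\<^sub>F r in at_right 0. ?q r \<le> ln (lo r) / ln r"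
      using assms(1) small by eventually_elim (auto intro!: divide_right_mono_neg)
  qed
  then have "((\<lambda>r. ereal (?q r)) \<longlongrightarrow> ereal l) (at_right 0)"
    by simp
  moreover have "\<forall>\<^sub>F r in at_right 0. corr_quotient X \<nu> A r = ereal (?q r)"
    using assms(1) by eventually_elim (auto simp: corr_quotient_eq)
  ultimately show ?thesis
    by (simp add: tendsto_cong)
qed

lemma ln_linear_over_ln: "0 < c \<Longrightarrow> ((\<lambda>r. ln (c * r) / ln r) \<longlongrightarrow> 1) (at_right (0::real))"
  by real_asymp

lemma ln_const_over_ln: "((\<lambda>r. ln c / ln r) \<longlongrightarrow> 0) (at_right (0::real))"
  by real_asymp

text \<open>
The function whose exponent is computed here bounds the correlation integral of the spiked measure
from below.
\<close>

lemma ln_log_over_ln: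
  "((\<lambda>r. ln (1 / (16 * log 2 (1 / r))) / ln r) \<longlongrightarrow> 0) (at_right (0::real))"
  by real_asymp

lemma ln_power_over_ln: "0 < c \<Longrightarrow> ((\<lambda>r. ln (c * r ^ 4) / ln r) \<longlongrightarrow> 4) (at_right (0::real))"
  by real_asymp

lemma eventually_small: "\<forall>\<^sub>F r in at_right 0. 0 < r \<and> r < (1 / 2 :: real)"
  using eventually_at_right_real[of 0 "1 / 2"] by simp

lemma borel_probsD:
  assumes "\<nu> \<in> borel_probs X"
  shows "sets \<nu> = sets (borel_of_metric X)" "prob_space \<nu>" "space \<nu> = mspace X"
  using assms sets_eq_imp_space_eq[of \<nu> "borel_of_metric X"]
  by (auto simp: borel_probs_def borel_of_metric_def space_measure_of_conv)

lemma openin_in_borel_of_metric: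
  assumes "openin (mtopology_of X) U"
  shows "U \<in> sets (borel_of_metric X)"
proof -
  have "{U. openin (mtopology_of X) U} \<subseteq> Pow (mspace X)"
    using openin_subset by fastforce
  then show ?thesis
    using assms by (simp add: borel_of_metric_def sets_measure_of)
qed

lemma mcball_of_in_borel_of_metric: "mcball_of X x r \<in> sets (borel_of_metric X)"
proof -
  interpret M: Metric_space "mspace X" "mdist X" by simp
  have "closedin (mtopology_of X) (mcball_of X x r)"
    by (simp add: mtopology_of_def mcball_of_def)
  then have "mspace X - mcball_of X x r \<in> sets (borel_of_metric X)"
    by (intro openin_in_borel_of_metric) (auto simp: closedin_def)
  then have "space (borel_of_metric X) - (mspace X - mcball_of X x r) \<in> sets (borel_of_metric X)"
    by blast
  moreover have "space (borel_of_metric X) - (mspace X - mcball_of X x r) = mcball_of X x r"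
    by (auto simp: borel_of_metric_def space_measure_of_conv)
  ultimately show ?thesis by simp
qed

text \<open>
The mass of a closed ball is an upper semi-continuous function of its centre: the masses of the
closed balls of radius \<open>r + 1 / (n + 1)\<close> about \<open>x\<close> decrease to the mass of the ball of radius
\<open>r\<close>, and the ball of radius \<open>r\<close> about a point near \<open>x\<close> lies in one of them.
\<close>

lemma borel_measurable_measure_mcball:
  assumes "\<nu> \<in> borel_probs X"
  shows "(\<lambda>x. measure \<nu> (mcball_of X x r)) \<in> borel_measurable \<nu>"
proof (rule borel_measurableI_less)
  fix c :: real
  interpret M: Metric_space "mspace X" "mdist X" by simp
  note \<nu> = borel_probsD[OF assms]
  interpret prob_space \<nu> by (rule \<nu>(2))
  have "openin (mtopology_of X) {x \<in> mspace X. measure \<nu> (mcball_of X x r) < c}"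
    unfolding mtopology_of_def M.openin_mtopology
  proof (intro conjI allI impI)
    fix x assume "x \<in> {x \<in> mspace X. measure \<nu> (mcball_of X x r) < c}"
    then have x: "x \<in> mspace X" "measure \<nu> (mcball_of X x r) < c" by auto
    define B where "B n = mcball_of X x (r + 1 / real (Suc n))" for n
    have "(\<lambda>n. measure \<nu> (B n)) \<longlonglongrightarrow> measure \<nu> (\<Inter>n. B n)"
    proof (rule finite_Lim_measure_decseq)
      show "range B \<subseteq> events"
        using mcball_of_in_borel_of_metric by (auto simp: B_def \<nu>)
      show "decseq B"
      proof (unfold decseq_def, intro allI impI)
        fix m n :: nat assume "m \<le> n"
        then have "1 / real (Suc n) \<le> 1 / real (Suc m)" by (simp add: frac_le)
        then show "B n \<subseteq> B m" by (auto simp: B_def)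
      qed
    qed
    moreover have "(\<Inter>n. B n) = mcball_of X x r"
    proof -
      have "mdist X x y \<le> r" if "\<And>n. mdist X x y \<le> r + 1 / real (Suc n)" for y
      proof (rule field_le_epsilon)
        fix e :: real assume "0 < e"
        then obtain n where "1 / real (Suc n) < e" using nat_approx_posE by blast
        then show "mdist X x y \<le> r + e" using that[of n] by simp
      qed
      moreover have "mdist X x y \<le> r + 1 / real (Suc n)" if "mdist X x y \<le> r" for y n
        using that by (rule order_trans) simp
      ultimately show ?thesis by (auto simp: B_def)
    qed
    ultimately have "\<forall>\<^sub>F n in sequentially. measure \<nu> (B n) < c"
      using x(2) by (simp add: order_tendstoD)
    then obtain n where n: "measure \<nu> (B n) < c"
      by (auto simp: eventually_sequentially)
    have "measure \<nu> (mcball_of X y r) < c" if "y \<in> M.mball x (1 / real (Suc n))" for y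
    proof -
      have "mcball_of X y r \<subseteq> B n"
      proof
        fix z assume z: "z \<in> mcball_of X y r"
        have "mdist X x z \<le> mdist X x y + mdist X y z"
          using that z x(1) by (intro M.triangle) auto
        then show "z \<in> B n" using that z x(1) by (auto simp: B_def)
      qed
      then have "measure \<nu> (mcball_of X y r) \<le> measure \<nu> (B n)"
        using mcball_of_in_borel_of_metric by (intro finite_measure_mono) (auto simp: B_def \<nu>)
      then show ?thesis using n by simp
    qed
    then show "\<exists>e>0. M.mball x e \<subseteq> {x \<in> mspace X. measure \<nu> (mcball_of X x r) < c}"
      by (intro exI[of _ "1 / real (Suc n)"]) auto
  qed auto
  then show "{x \<in> space \<nu>. measure \<nu> (mcball_of X x r) < c} \<in> sets \<nu>"
    using openin_in_borel_of_metric by (simp add: \<nu>)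
qed

lemma corr_integrable:
  assumes "\<nu> \<in> borel_probs X" and A: "A \<in> sets (borel_of_metric X)"
  shows "integrable \<nu> (\<lambda>x. indicator A x *\<^sub>R measure \<nu> (mcball_of X x r))"
proof -
  note \<nu> = borel_probsD[OF assms(1)]
  interpret prob_space \<nu> by (rule \<nu>(2))
  show ?thesis
    using A borel_measurable_measure_mcball[OF assms(1)]
    by (intro integrable_const_bound[where B=1] borel_measurable_scaleR borel_measurable_indicator)
      (auto simp: \<nu> indicator_def)
qed

lemma corr_integral_ge:
  assumes "\<nu> \<in> borel_probs X" "A \<in> sets (borel_of_metric X)" "E \<in> sets (borel_of_metric X)" "E \<subseteq> A"
    and c: "\<And>x. x \<in> E \<Longrightarrow> c \<le> measure \<nu> (mcball_of X x r)"
  shows "c * measure \<nu> E \<le> corr_integral X \<nu> A r"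
proof -
  note \<nu> = borel_probsD[OF assms(1)]
  interpret prob_space \<nu> by (rule \<nu>(2))
  have "c * measure \<nu> E = (LINT x|\<nu>. indicator E x *\<^sub>R c)"
    using assms(3) sets.Int_space_eq2[of E \<nu>] by (simp add: \<nu> mult.commute)
  also have "\<dots> \<le> corr_integral X \<nu> A r"
    unfolding corr_integral_def set_lebesgue_integral_def
  proof (rule integral_mono)
    show "integrable \<nu> (\<lambda>x. indicator E x *\<^sub>R c)"
      using assms(3) by (intro integrable_const_bound[where B="\<bar>c\<bar>"]
          borel_measurable_scaleR borel_measurable_indicator) (auto simp: \<nu> indicator_def)
    show "integrable \<nu> (\<lambda>x. indicator A x *\<^sub>R measure \<nu> (mcball_of X x r))"
      using assms by (intro corr_integrable)
  qed (use assms in \<open>auto simp: indicator_def\<close>)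
  finally show ?thesis .
qed

lemma corr_integral_le:
  assumes "\<nu> \<in> borel_probs X" "A \<in> sets (borel_of_metric X)"
    and c: "\<And>x. x \<in> mspace X \<Longrightarrow> measure \<nu> (mcball_of X x r) \<le> c" and "0 \<le> c"
  shows "corr_integral X \<nu> A r \<le> c"
proof -
  note \<nu> = borel_probsD[OF assms(1)]
  interpret prob_space \<nu> by (rule \<nu>(2))
  show ?thesis
    unfolding corr_integral_def set_lebesgue_integral_def
    using assms by (intro integral_le_const corr_integrable) (auto simp: indicator_def \<nu>)
qed

lemma corr_integral_le_1:
  assumes "\<nu> \<in> borel_probs X" "A \<in> sets (borel_of_metric X)"
  shows "corr_integral X \<nu> A r \<le> 1"
  using assms by (intro corr_integral_le) (auto simp: borel_probs_def intro!: prob_space.prob_le_1)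

text \<open>
The supremum in \<^const>\<open>dim_MC\<close> needs no estimate if all admissible sets of nearly full measure
have the same exponent: it is then constant for small \<open>\<delta>\<close>, because the whole space is
admissible. Sets without an exponent do no harm, which is essential for the spiked measure below.
\<close>

lemma dims_eqI:
  assumes \<nu>: "\<nu> \<in> borel_probs X"
    and full: "(corr_quotient X \<nu> (mspace X) \<longlongrightarrow> l) (at_right 0)"
    and pinned: "\<And>A l'. A \<in> sets (borel_of_metric X) \<Longrightarrow> 1 - \<delta> \<le> measure \<nu> A \<Longrightarrow>
        (corr_quotient X \<nu> A \<longlongrightarrow> l') (at_right 0) \<Longrightarrow> l' = l"
    and "0 < \<delta>"
  shows "\<nu> \<in> dim_C_domain X" "dim_C X \<nu> = l" "\<nu> \<in> dim_MC_domain X" "dim_MC X \<nu> = l"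
proof -
  interpret prob_space \<nu> using borel_probsD[OF \<nu>] by simp
  have ntriv: "at_right (0::real) \<noteq> bot" by simp
  have lim: "corr_limit X \<nu> A = l'" if "(corr_quotient X \<nu> A \<longlongrightarrow> l') (at_right 0)" for A l'
    using tendsto_Lim[OF ntriv that] by (simp add: corr_limit_def)
  show "\<nu> \<in> dim_C_domain X" "dim_C X \<nu> = l"
    using \<nu> full by (auto simp: dim_C_domain_def corr_limit_exists_def dim_C_def lim)
  have UN: "mspace X \<in> MC_sets X \<nu> d" if "0 < d" for d
    using full that borel_probsD[OF \<nu>] prob_space sets.top[of \<nu>]
    by (auto simp: MC_sets_def corr_limit_exists_def)
  then show "\<nu> \<in> dim_MC_domain X"
    using \<nu> by (auto simp: dim_MC_domain_def)
  have "(SUP A\<in>MC_sets X \<nu> d. corr_limit X \<nu> A) = l" if "0 < d" "d < \<delta>" for d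
  proof (rule antisym)
    show "(SUP A\<in>MC_sets X \<nu> d. corr_limit X \<nu> A) \<le> l"
    proof (rule SUP_least)
      fix A assume "A \<in> MC_sets X \<nu> d"
      then show "corr_limit X \<nu> A \<le> l"
        using pinned[of A] that by (auto simp: MC_sets_def corr_limit_exists_def lim)
    qed
    show "l \<le> (SUP A\<in>MC_sets X \<nu> d. corr_limit X \<nu> A)"
      using SUP_upper[OF UN[OF that(1)], of "corr_limit X \<nu>"] lim[OF full] by simp
  qed
  then have "\<forall>\<^sub>F d in at_right 0. (SUP A\<in>MC_sets X \<nu> d. corr_limit X \<nu> A) = l"
    using \<open>0 < \<delta>\<close> by (auto simp: eventually_at_right_field)
  then show "dim_MC X \<nu> = l"
    unfolding dim_MC_def by (intro tendsto_Lim tendsto_eventually) simp_all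
qed

section \<open>A space with sparse distances on one half-line\<close>

text \<open>
These are the positive distances on the nonnegative half-line and, from index 1 on, also the
lengths of the half-open intervals that serve as balls there. Each is the fourth power of its predecessor, so
that the logarithms of consecutive distances have the fixed ratio 4.
\<close>

definition width :: "nat \<Rightarrow> real" where "width k = (1 / 2) ^ (4 ^ k)"

lemma width_pos [simp]: "0 < width k" and width_nonneg [simp]: "0 \<le> width k"
  by (simp_all add: width_def)

lemma width_nonzero: "width k \<noteq> 0"
  by (simp add: width_def)

lemma width_0: "width 0 = 1 / 2"
  by (simp add: width_def)

lemma width_Suc: "width (Suc k) = width k ^ 4"
  by (simp add: width_def power_mult[symmetric] mult.commute)

lemma width_antimono: "i \<le> j \<Longrightarrow> width j \<le> width i"
  by (simp add: width_def power_decreasing)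

lemma width_strict_antimono: "i < j \<Longrightarrow> width j < width i"
  by (simp add: width_def power_strict_decreasing)

lemma width_le_half: "width k \<le> 1 / 2"
  using width_antimono[of 0 k] by (simp add: width_0)

lemma width_lt_1 [simp]: "width k < 1"
  using width_le_half[of k] by linarith

lemma width_tendsto_0: "width \<longlonglongrightarrow> 0"
proof (rule tendsto_sandwich[where f="\<lambda>_. 0" and h="\<lambda>k. (1/2)^k :: real"])
  show "\<forall>\<^sub>F k in sequentially. width k \<le> (1 / 2) ^ k"
    unfolding width_def by (intro always_eventually allI power_decreasing) (auto intro: less_imp_le power_gt_expt)
qed (simp_all add: LIMSEQ_realpow_zero)

lemma ex_width_less: "0 < e \<Longrightarrow> \<exists>k. width k < e"
  using order_tendstoD(2)[OF width_tendsto_0, of e] by (auto simp: eventually_sequentially)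

lemma ex_width_interval:
  assumes "0 < r" "r < 1 / 2"
  obtains k where "width (Suc k) \<le> r" "r < width k"
proof -
  obtain m where "width m \<le> r" using ex_width_less[OF assms(1)] by (auto intro: less_imp_le)
  moreover have "\<not> width 0 \<le> r" using assms by (simp add: width_0)
  ultimately obtain k where "k < m" "\<not> width k \<le> r" "width (Suc k) \<le> r"
    using ex_least_nat_less[of "\<lambda>k. width k \<le> r" m] by auto
  then show ?thesis using that by auto
qed

definition cell :: "nat \<Rightarrow> real \<Rightarrow> int" where "cell k x = \<lfloor>x / width (Suc k)\<rfloor>"

text \<open>
The length of a cell at level \<open>j\<close> is an integer multiple of the length at any level \<open>k \<ge> j\<close>, so
the partitions into cells are nested.
\<close>

lemma cell_coarsen:
  assumes "cell k x = cell k y" "j \<le> k"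
  shows "cell j x = cell j y"
proof -
  define m :: nat where "m = 2 ^ (4 ^ Suc k - 4 ^ Suc j)"
  have le: "(4::nat) ^ Suc j \<le> 4 ^ Suc k"
    using assms(2) by (intro power_increasing) auto
  have m: "width (Suc j) = width (Suc k) * real m"
  proof -
    have "(1/2::real) ^ (4 ^ Suc k) = (1/2) ^ (4 ^ Suc j) * (1/2) ^ (4 ^ Suc k - 4 ^ Suc j)"
      using le by (simp only: power_add[symmetric] le_add_diff_inverse)
    then show ?thesis
      by (simp only: width_def m_def) (simp add: power_divide)
  qed
  have "cell j z = cell k z div int m" for z
    using floor_divide_real_eq_div[of "int m" "z / width (Suc k)"]
    by (simp add: cell_def m divide_divide_eq_left)
  then show ?thesis using assms by simp
qed

lemma cell_eq_iff:
  "cell k y = j \<longleftrightarrow> real_of_int j * width (Suc k) \<le> y \<and> y < real_of_int (j + 1) * width (Suc k)"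
  by (simp add: cell_def floor_eq_iff pos_le_divide_eq pos_divide_less_eq)

lemma cell_eq_dist:
  assumes "cell k x = cell k y"
  shows "\<bar>x - y\<bar> < width (Suc k)"
  using cell_eq_iff[of k x "cell k x"] cell_eq_iff[of k y "cell k y"] assms
  by (auto simp: algebra_simps abs_less_iff)

lemma ex_cell_neq:
  assumes "x \<noteq> y"
  shows "\<exists>k. cell k x \<noteq> cell k y"
proof -
  obtain k where "width k < \<bar>x - y\<bar>" using ex_width_less[of "\<bar>x - y\<bar>"] assms by auto
  then show ?thesis
    using cell_eq_dist[of k x y] width_antimono[of k "Suc k"] by force
qed

text \<open>
The ultrametric of the nested partitions. The index is arranged so that two points in a common
cell of level \<open>k\<close>, of length \<open>width (Suc k)\<close>, have distance at most \<open>width (Suc k)\<close>.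
\<close>

definition cell_dist :: "real \<Rightarrow> real \<Rightarrow> real" where
  "cell_dist x y = (if x = y then 0 else width (LEAST k. cell k x \<noteq> cell k y))"

text \<open>
No distance lies strictly between \<open>width (Suc k)\<close> and \<open>width k\<close>, so a closed ball does not change
while its radius ranges over this interval.
\<close>

lemma cell_dist_le_iff:
  assumes r: "width (Suc k) \<le> r" "r < width k"
  shows "cell_dist x y \<le> r \<longleftrightarrow> cell k x = cell k y"
proof (cases "x = y")
  case True
  then show ?thesis using r(1) width_pos[of "Suc k"] by (simp add: cell_dist_def del: width_pos)
next
  case False
  define L where "L = (LEAST k. cell k x \<noteq> cell k y)"
  have L: "cell L x \<noteq> cell L y"
    unfolding L_def using ex_cell_neq[OF False] by (rule LeastI_ex)
  have "cell_dist x y = width L"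
    using False by (simp add: cell_dist_def L_def)
  then have "cell_dist x y \<le> r \<longleftrightarrow> \<not> L \<le> k"
    using r width_antimono[of L k] width_antimono[of "Suc k" L] by linarith
  also have "\<dots> \<longleftrightarrow> cell k x = cell k y"
    using L cell_coarsen[of k x y L] not_less_Least[of k "\<lambda>k. cell k x \<noteq> cell k y"]
    by (auto simp: L_def[symmetric])
  finally show ?thesis .
qed

lemma cell_dist_bounds: "0 \<le> cell_dist x y" "cell_dist x y < 1"
  by (auto simp: cell_dist_def)

lemma cell_dist_triangle: "cell_dist x z \<le> cell_dist x y + cell_dist y z"
proof (cases "x = y \<or> y = z \<or> x = z")
  case True
  then show ?thesis using cell_dist_bounds[of x y] cell_dist_bounds[of y z]
    by (auto simp: cell_dist_def)
next
  case False
  define L where "L = (LEAST k. cell k x \<noteq> cell k z)"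
  have "cell L x \<noteq> cell L z"
    unfolding L_def by (rule LeastI_ex) (use ex_cell_neq[of x z] False in simp)
  then consider "cell L x \<noteq> cell L y" | "cell L y \<noteq> cell L z" by fastforce
  then have "width L \<le> cell_dist x y \<or> width L \<le> cell_dist y z"
    by cases (use False in \<open>auto simp: cell_dist_def intro!: width_antimono Least_le\<close>)
  moreover have "cell_dist x z = width L" using False by (simp add: cell_dist_def L_def)
  ultimately show ?thesis using cell_dist_bounds[of x y] cell_dist_bounds[of y z] by linarith
qed

text \<open>
An ultrametric half-line and a Euclidean one with truncated distance. Both have diameter at most
1, so that placing them at mutual distance 1 preserves the triangle inequality. The carrier is the
whole line, which lets the measures below live on the usual Borel algebra.
\<close>

definition mixed_dist :: "real \<Rightarrow> real \<Rightarrow> real" where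
  "mixed_dist x y =
     (if 0 \<le> x \<and> 0 \<le> y then cell_dist x y
      else if x < 0 \<and> y < 0 then min 1 \<bar>x - y\<bar> else 1)"

definition mixed_space :: "real metric" where
  "mixed_space = metric (UNIV, mixed_dist)"

lemma Metric_space_mixed_dist: "Metric_space UNIV mixed_dist"
proof
  fix x y z :: real
  show "0 \<le> mixed_dist x y"
    using cell_dist_bounds by (auto simp: mixed_dist_def)
  have "cell_dist x y = cell_dist y x"
    by (simp add: cell_dist_def eq_commute)
  then show "mixed_dist x y = mixed_dist y x"
    by (auto simp: mixed_dist_def)
  show "mixed_dist x y = 0 \<longleftrightarrow> x = y"
    by (auto simp: mixed_dist_def cell_dist_def min_def less_imp_neq[OF width_pos, symmetric])
  show "mixed_dist x z \<le> mixed_dist x y + mixed_dist y z"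
    using cell_dist_triangle[of x z y] cell_dist_bounds[of x z] cell_dist_bounds[of x y]
      cell_dist_bounds[of y z]
    by (auto simp: mixed_dist_def min_def)
qed

lemma mspace_mixed_space [simp]: "mspace mixed_space = UNIV"
  and mdist_mixed_space [simp]: "mdist mixed_space = mixed_dist"
  by (simp_all add: mixed_space_def Metric_space.mspace_metric Metric_space.mdist_metric
      Metric_space_mixed_dist)

lemma openin_mixed_space:
  "openin (mtopology_of mixed_space) U \<longleftrightarrow> (\<forall>x\<in>U. \<exists>e>0. \<forall>y. mixed_dist x y < e \<longrightarrow> y \<in> U)"
proof -
  interpret Metric_space UNIV mixed_dist by (rule Metric_space_mixed_dist)
  show ?thesis
    by (auto simp: mtopology_of_def openin_mtopology subset_iff)
qed

section \<open>The Borel sets of the mixed space\<close>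

text \<open>
The new distance bounds the Euclidean one whenever it is small.
\<close>

lemma openin_mixed_space_of_open:
  assumes "open U"
  shows "openin (mtopology_of mixed_space) U"
  unfolding openin_mixed_space
proof
  fix x assume "x \<in> U"
  then obtain e where "0 < e" and ball: "ball x e \<subseteq> U"
    using assms open_contains_ball[of U] by auto
  obtain k where k: "width k < e" using ex_width_less[OF \<open>0 < e\<close>] by blast
  have "\<bar>x - y\<bar> < e" if d: "mixed_dist x y < min e (width (Suc k))" for y
  proof (cases "0 \<le> x \<and> 0 \<le> y")
    case True
    then have "cell_dist x y \<le> width (Suc k)" using d by (simp add: mixed_dist_def)
    then have "cell k x = cell k y"
      using cell_dist_le_iff[of k "width (Suc k)"] by (simp add: width_strict_antimono)
    then show ?thesis
      using cell_eq_dist[of k x y] k width_antimono[of k "Suc k"] by simp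
  next
    case False
    moreover have "mixed_dist x y < e" "mixed_dist x y < width (Suc k)"
      using d by simp_all
    moreover from this(2) have "mixed_dist x y < 1"
      using width_lt_1[of "Suc k"] by linarith
    ultimately show ?thesis
      by (auto simp: mixed_dist_def min_def split: if_splits)
  qed
  then show "\<exists>e>0. \<forall>y. mixed_dist x y < e \<longrightarrow> y \<in> U"
    using ball \<open>0 < e\<close>
    by (intro exI[of _ "min e (width (Suc k))"]) (auto simp: subset_iff dist_real_def)
qed

text \<open>
The identity from the Euclidean line to the mixed space is not continuous, since cells are
half-open. But an open set of the mixed space
contains with each nonnegative point one of countably many cells around it.
\<close>

lemma openin_mixed_space_borel:
  assumes U: "openin (mtopology_of mixed_space) U"
  shows "U \<in> sets borel"
proof -
  define C where "C p = {y. 0 \<le> y \<and> cell (fst p) y = snd p}" for p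
  have C: "C p \<in> sets borel" for p
  proof -
    have "C p = {0..} \<inter> {real_of_int (snd p) * width (Suc (fst p)) ..<
        real_of_int (snd p + 1) * width (Suc (fst p))}"
      unfolding C_def cell_eq_iff by auto
    then show ?thesis by simp
  qed
  have nbhd: "\<exists>e>0. \<forall>y. mixed_dist x y < e \<longrightarrow> y \<in> U" if "x \<in> U" for x
    using U that unfolding openin_mixed_space by blast
  have "U \<inter> {0..} = (\<Union>p\<in>{p. C p \<subseteq> U}. C p)"
  proof (intro equalityI subsetI)
    fix x assume x: "x \<in> U \<inter> {0..}"
    then obtain e where e: "0 < e" "\<And>y. mixed_dist x y < e \<Longrightarrow> y \<in> U"
      using nbhd by blast
    obtain k where k: "width k < e" using ex_width_less[OF e(1)] by blast
    have "C (k, cell k x) \<subseteq> U"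
    proof
      fix y assume "y \<in> C (k, cell k x)"
      then have "cell k x = cell k y" "0 \<le> y" by (auto simp: C_def)
      then have "mixed_dist x y \<le> width (Suc k)"
        using cell_dist_le_iff[of k "width (Suc k)" x y] x
        by (simp add: width_strict_antimono mixed_dist_def)
      then show "y \<in> U" using e(2) k width_antimono[of k "Suc k"] by simp
    qed
    moreover have "x \<in> C (k, cell k x)" using x by (simp add: C_def)
    ultimately show "x \<in> (\<Union>p\<in>{p. C p \<subseteq> U}. C p)" by blast
  qed (auto simp: C_def)
  also have "\<dots> \<in> sets borel"
    using C by (intro sets.countable_UN') auto
  finally have pos: "U \<inter> {0..} \<in> sets borel" .
  have "open (U \<inter> {..<0})"
    unfolding open_dist
  proof
    fix x assume x: "x \<in> U \<inter> {..<0}"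
    then obtain e where e: "0 < e" "\<And>y. mixed_dist x y < e \<Longrightarrow> y \<in> U"
      using nbhd by blast
    have "y \<in> U \<inter> {..<0}" if "dist y x < min e (- x)" for y
    proof -
      have "y < 0" "\<bar>x - y\<bar> < e" using that by (auto simp: dist_real_def)
      then show ?thesis using x e(2)[of y] by (simp add: mixed_dist_def)
    qed
    then show "\<exists>e>0. \<forall>y. dist y x < e \<longrightarrow> y \<in> U \<inter> {..<0}"
      using x e(1) by (intro exI[of _ "min e (- x)"]) auto
  qed
  then have "U \<inter> {0..} \<union> U \<inter> {..<0} \<in> sets borel"
    using pos by (intro sets.Un) auto
  moreover have "U \<inter> {0..} \<union> U \<inter> {..<0} = U" by auto
  ultimately show ?thesis by simp
qed

lemma sets_borel_of_mixed_space [simp]: "sets (borel_of_metric mixed_space) = sets borel"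
proof (rule equalityI)
  have "space (borel_of_metric mixed_space) = UNIV"
    by (simp add: borel_of_metric_def space_measure_of_conv)
  moreover have "{S. open S} \<subseteq> sets (borel_of_metric mixed_space)"
    using openin_in_borel_of_metric openin_mixed_space_of_open by blast
  ultimately show "sets borel \<subseteq> sets (borel_of_metric mixed_space)"
    using sets.sigma_sets_subset[of "{S. open S}" "borel_of_metric mixed_space"]
    by (simp add: borel_def sets_measure_of_conv)
  have "{U. openin (mtopology_of mixed_space) U} \<subseteq> sets borel"
    using openin_mixed_space_borel by blast
  then show "sets (borel_of_metric mixed_space) \<subseteq> sets borel"
    using sets.sigma_sets_subset[of "{U. openin (mtopology_of mixed_space) U}" "borel :: real measure"]
    by (simp add: borel_of_metric_def sets_measure_of_conv)
qed

section \<open>Closed balls of the mixed space\<close>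

lemma mcball_mixed_space_borel [measurable]: "mcball_of mixed_space x r \<in> sets borel"
  using mcball_of_in_borel_of_metric[of mixed_space x r] by simp

lemma mixed_ball_nonneg:
  assumes "0 \<le> x" "width (Suc k) \<le> r" "r < width k"
  shows "mcball_of mixed_space x r = {y. 0 \<le> y \<and> cell k y = cell k x}"
proof -
  have "\<not> 1 \<le> r" using assms(3) width_lt_1[of k] by linarith
  then show ?thesis
    using assms(1) cell_dist_le_iff[OF assms(2,3), of x]
    by (auto simp: mixed_dist_def split: if_splits)
qed

lemma mixed_ball_neg:
  assumes "x < 0" "r < 1"
  shows "mcball_of mixed_space x r \<subseteq> {..<0}"
  using assms by (auto simp: mixed_dist_def split: if_splits)

lemma mixed_ball_subset:
  assumes "0 < r" "r < 1 / 2"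
  shows "mcball_of mixed_space x r \<subseteq> {x - r..x + r}"
proof
  fix y assume y: "y \<in> mcball_of mixed_space x r"
  obtain k where k: "width (Suc k) \<le> r" "r < width k" using ex_width_interval[OF assms] .
  have "\<bar>x - y\<bar> \<le> r"
  proof (cases "0 \<le> x")
    case True
    then show ?thesis
      using y mixed_ball_nonneg[OF True k] cell_eq_dist[of k x y] k by auto
  next
    case False
    then show ?thesis
      using y assms by (auto simp: mixed_dist_def min_def split: if_splits)
  qed
  then show "y \<in> {x - r..x + r}" by auto
qed

section \<open>Geometric mixtures and total variation\<close>

text \<open>
The component \<open>c k\<close> receives the weight \<open>(1 / 2) ^ Suc k\<close>. What matters is that the weights are
positive and that the distances of the ultrametric part decay much faster.
\<close>

definition mixture :: "(nat \<Rightarrow> real measure) \<Rightarrow> real measure" where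
  "mixture c = measure_pmf (geometric_pmf (1 / 2)) \<bind> c"

definition splice :: "nat \<Rightarrow> (nat \<Rightarrow> 'a) \<Rightarrow> (nat \<Rightarrow> 'a) \<Rightarrow> nat \<Rightarrow> 'a" where
  "splice n c c' = (\<lambda>k. if k < n then c k else c' k)"

lemma components_measurable:
  assumes "\<And>k. c k \<in> borel_probs mixed_space"
  shows "c \<in> measurable (measure_pmf p) (subprob_algebra borel)"
  using assms
  by (auto simp: space_subprob_algebra borel_probs_def intro: prob_space_imp_subprob_space)

lemma mixture_in_borel_probs:
  assumes "\<And>k. c k \<in> borel_probs mixed_space"
  shows "mixture c \<in> borel_probs mixed_space"
proof -
  have "prob_space (mixture c)"
    unfolding mixture_def using assms
    by (intro measure_pmf.prob_space_bind[OF _ components_measurable]) (auto simp: borel_probs_def)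
  moreover have "sets (mixture c) = sets borel"
    unfolding mixture_def using assms by (intro sets_bind) (auto simp: borel_probs_def)
  ultimately show ?thesis by (simp add: borel_probs_def)
qed

lemma measure_mixture:
  assumes "\<And>k. c k \<in> borel_probs mixed_space" "A \<in> sets borel"
  shows "measure (mixture c) A = measure_pmf.expectation (geometric_pmf (1 / 2)) (\<lambda>k. measure (c k) A)"
  unfolding mixture_def by (rule measure_pmf.measure_bind[OF components_measurable]) (use assms in auto)

lemma integrable_measure_component:
  assumes "\<And>k. c k \<in> borel_probs mixed_space"
  shows "integrable (measure_pmf p) (\<lambda>k. measure (c k) A)"
  using assms
  by (intro measure_pmf.integrable_const_bound[where B=1])
    (auto simp: borel_probs_def intro!: prob_space.prob_le_1)

lemma measure_mixture_ge:
  assumes c: "\<And>k. c k \<in> borel_probs mixed_space" and A: "A \<in> sets borel"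
  shows "(1 / 2) ^ Suc k * measure (c k) A \<le> measure (mixture c) A"
proof -
  let ?G = "measure_pmf (geometric_pmf (1 / 2))"
  have "(1 / 2) ^ Suc k * measure (c k) A = (LINT j|?G. indicator {k} j * measure (c k) A)"
    by (simp add: measure_pmf_single)
  also have "\<dots> \<le> (LINT j|?G. measure (c j) A)"
  proof (rule integral_mono)
    show "integrable ?G (\<lambda>j. indicator {k} j * measure (c k) A)"
      by (intro measure_pmf.integrable_const_bound[where B="measure (c k) A"])
        (auto simp: indicator_def)
  qed (use integrable_measure_component[OF c] in \<open>auto simp: indicator_def\<close>)
  finally show ?thesis by (simp add: measure_mixture[OF assms])
qed

lemma measure_mixture_le:
  assumes c: "\<And>k. c k \<in> borel_probs mixed_space" and A: "A \<in> sets borel"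
    and "\<And>k. measure (c k) A \<le> b"
  shows "measure (mixture c) A \<le> b"
  unfolding measure_mixture[OF c A]
  using assms integrable_measure_component[OF c] by (intro measure_pmf.integral_le_const) auto

lemma splice_in_borel_probs:
  assumes "\<And>k. c k \<in> borel_probs X" "\<And>k. c' k \<in> borel_probs X"
  shows "splice n c c' k \<in> borel_probs X"
  using assms by (simp add: splice_def)

text \<open>
Changing the components from index \<open>n\<close> on moves at most the total weight of these components,
which tends to zero, whatever the new components are.
\<close>

lemma tv_dist_mixture_splice:
  assumes c: "\<And>k. c k \<in> borel_probs mixed_space" and c': "\<And>k. c' k \<in> borel_probs mixed_space"
  shows "(\<lambda>n. tv_dist mixed_space (mixture (splice n c c')) (mixture c)) \<longlonglongrightarrow> 0"
proof -
  let ?G = "measure_pmf (geometric_pmf (1 / 2))"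
  have diff: "\<bar>measure (mixture (splice n c c')) A - measure (mixture c) A\<bar> \<le> measure ?G {n..}"
    if A: "A \<in> sets borel" for A n
  proof -
    let ?f = "\<lambda>k. measure (splice n c c' k) A" and ?g = "\<lambda>k. measure (c k) A"
    note s = splice_in_borel_probs[OF c c', of n]
    have int: "integrable ?G ?f" "integrable ?G ?g"
      by (intro integrable_measure_component s c)+
    have le1: "measure (c k) A \<le> 1" "measure (c' k) A \<le> 1" for k
      using c[of k] c'[of k] by (auto simp: borel_probs_def intro!: prob_space.prob_le_1)
    have "\<bar>?f k - ?g k\<bar> \<le> indicator {n..} k" for k
      using le1[of k] measure_nonneg[of "c k" A] measure_nonneg[of "c' k" A]
      by (simp add: splice_def indicator_def abs_le_iff; linarith)
    moreover have "integrable ?G (\<lambda>k. \<bar>?f k - ?g k\<bar>)"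
      using int by (intro integrable_abs Bochner_Integration.integrable_diff)
    moreover have "integrable ?G (indicator {n..} :: nat \<Rightarrow> real)"
      by (intro measure_pmf.integrable_const_bound[where B=1]) (auto simp: indicator_def)
    ultimately have "(LINT k|?G. \<bar>?f k - ?g k\<bar>) \<le> (LINT k|?G. indicator {n..} k)"
      by (intro integral_mono) auto
    moreover have "\<bar>LINT k|?G. ?f k - ?g k\<bar> \<le> (LINT k|?G. \<bar>?f k - ?g k\<bar>)"
      by (rule integral_abs_bound)
    ultimately show ?thesis
      using int by (simp add: measure_mixture[OF s A] measure_mixture[OF c A])
  qed
  have tail: "(\<lambda>n. measure ?G {n..}) \<longlonglongrightarrow> measure ?G (\<Inter>n. {n..})"
    by (rule measure_pmf.finite_Lim_measure_decseq) (auto simp: decseq_def)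
  have "(\<Inter>n::nat. {n..}) = {}" using Suc_n_not_le_n by blast
  with tail have tail0: "(\<lambda>n. measure ?G {n..}) \<longlonglongrightarrow> 0" by simp
  show ?thesis
  proof (rule tendsto_sandwich[OF _ _ tendsto_const tail0])
    let ?d = "\<lambda>n A. \<bar>measure (mixture (splice n c c')) A - measure (mixture c) A\<bar>"
    have "0 \<le> (SUP A\<in>sets borel. ?d n A)" for n
      by (rule cSUP_upper2[where x="{}"]) (auto intro!: bdd_aboveI2 diff)
    then show "\<forall>\<^sub>F n in sequentially. 0 \<le> tv_dist mixed_space (mixture (splice n c c')) (mixture c)"
      by (simp add: tv_dist_def)
    have "(SUP A\<in>sets borel. ?d n A) \<le> measure ?G {n..}" for n
      by (rule cSUP_least) (auto intro!: diff)
    then show "\<forall>\<^sub>F n in sequentially.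
        tv_dist mixed_space (mixture (splice n c c')) (mixture c) \<le> measure ?G {n..}"
      by (simp add: tv_dist_def)
  qed
qed

section \<open>Spiked, truncated and atomic mixtures\<close>

definition uniform_on :: "real \<Rightarrow> real \<Rightarrow> real measure" where
  "uniform_on a b = uniform_measure lborel {a..<b}"

lemma uniform_on_in_borel_probs:
  assumes "a < b"
  shows "uniform_on a b \<in> borel_probs mixed_space"
  using assms unfolding borel_probs_def uniform_on_def
  by (auto intro!: prob_space_uniform_measure)

lemma measure_uniform_on:
  assumes "a < b" "A \<in> sets borel"
  shows "measure (uniform_on a b) A = measure lborel ({a..<b} \<inter> A) / (b - a)"
  using assms by (simp add: uniform_on_def)

text \<open>
The intervals shrink doubly exponentially while their weights in the mixture decay only
exponentially, so the density of \<open>spiked\<close>, which is at least 1 on \<open>{0..<1 / 2}\<close>, has a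
non-square-integrable peak at 0. It becomes bounded if only finitely many components are kept.
\<close>

definition spike :: "nat \<Rightarrow> real measure" where "spike k = uniform_on 0 (width k)"

definition flat_measure :: "real measure" where "flat_measure = uniform_on (-1) 0"

definition spiked :: "real measure" where "spiked = mixture spike"

definition truncated :: "nat \<Rightarrow> real measure" where
  "truncated n = mixture (splice n spike (\<lambda>_. flat_measure))"

definition atom :: "real measure" where "atom = return borel 0"

definition with_atom :: "nat \<Rightarrow> real measure" where
  "with_atom n = mixture (splice n (\<lambda>_. flat_measure) (\<lambda>_. atom))"

lemma components:
  "spike k \<in> borel_probs mixed_space" "flat_measure \<in> borel_probs mixed_space"
  "atom \<in> borel_probs mixed_space"
  by (auto simp: spike_def flat_measure_def atom_def uniform_on_in_borel_probs)
    (auto simp: borel_probs_def prob_space_return)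

lemma spliced:
  "splice n spike (\<lambda>_. flat_measure) k \<in> borel_probs mixed_space"
  "splice n (\<lambda>_. flat_measure) (\<lambda>_. atom) k \<in> borel_probs mixed_space"
  by (simp_all add: splice_in_borel_probs components)

lemma borel_probs_mixed_spaceD:
  assumes "\<nu> \<in> borel_probs mixed_space"
  shows "prob_space \<nu>" "sets \<nu> = sets borel"
  using assms by (auto simp: borel_probs_def)

lemma spiked_in: "spiked \<in> borel_probs mixed_space"
  unfolding spiked_def by (intro mixture_in_borel_probs components)

lemma truncated_in: "truncated n \<in> borel_probs mixed_space"
  unfolding truncated_def by (intro mixture_in_borel_probs spliced)

lemma with_atom_in: "with_atom n \<in> borel_probs mixed_space"
  unfolding with_atom_def by (intro mixture_in_borel_probs spliced)

section \<open>The spiked measure has both dimensions zero\<close>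

lemma measure_spiked_outside: "measure spiked (- {0..<1 / 2}) = 0"
proof -
  have "measure (spike k) (- {0..<1 / 2}) \<le> 0" for k
  proof -
    have "{0..<width k} \<inter> - {0..<1 / 2} = {}" using width_le_half[of k] by auto
    then show ?thesis by (simp add: spike_def measure_uniform_on)
  qed
  then have "measure spiked (- {0..<1 / 2}) \<le> 0"
    unfolding spiked_def by (intro measure_mixture_le components) auto
  then show ?thesis using measure_nonneg[of spiked "- {0..<1 / 2}"] by linarith
qed

lemma measure_spiked_Int:
  assumes "A \<in> sets borel"
  shows "measure spiked (A \<inter> {0..<1 / 2}) = measure spiked A"
proof -
  interpret prob_space spiked by (rule borel_probs_mixed_spaceD[OF spiked_in])
  have "measure spiked A \<le> measure spiked (A \<inter> {0..<1/2} \<union> - {0..<1/2})"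
    using assms by (intro finite_measure_mono) (auto simp: borel_probs_mixed_spaceD[OF spiked_in])
  also have "\<dots> \<le> measure spiked (A \<inter> {0..<1/2}) + measure spiked (- {0..<1/2})"
    using assms by (intro measure_Un_le) (auto simp: borel_probs_mixed_spaceD[OF spiked_in])
  finally have "measure spiked A \<le> measure spiked (A \<inter> {0..<1/2})"
    by (simp add: measure_spiked_outside)
  moreover have "measure spiked (A \<inter> {0..<1/2}) \<le> measure spiked A"
    using assms by (intro finite_measure_mono) (auto simp: borel_probs_mixed_spaceD[OF spiked_in])
  ultimately show ?thesis by simp
qed

text \<open>
The component of index 0 is uniform on \<open>{0..<1 / 2}\<close> with weight \<open>1 / 2\<close>, so \<open>spiked\<close>
dominates Lebesgue measure there, and the cell that forms the ball does not leave this interval,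
as its length divides \<open>1 / 2\<close>.
\<close>

lemma measure_spiked_ball_ge:
  assumes x: "x \<in> {0..<1 / 2}" and r: "width (Suc k) \<le> r" "r < width k"
  shows "width (Suc k) \<le> measure spiked (mcball_of mixed_space x r)"
proof -
  interpret prob_space spiked by (rule borel_probs_mixed_spaceD[OF spiked_in])
  define j w where "j = cell k x" and "w = width (Suc k)"
  have j: "real_of_int j * w \<le> x" "x < real_of_int (j + 1) * w"
    using cell_eq_iff[of k x j] by (auto simp: j_def w_def)
  have "0 < w" by (simp add: w_def)
  have "j \<ge> 0" using x by (auto simp: j_def cell_def)
  have "real_of_int (j + 1) * w \<le> 1 / 2"
  proof -
    \<comment> \<open>\<open>N\<close> is the number of cells of length \<open>w\<close> in \<open>{0..<1 / 2}\<close>.\<close>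
    define N :: int where "N = 2 ^ (4 ^ Suc k - 1)"
    have "(2::real) ^ (4 ^ Suc k) = 2 * 2 ^ (4 ^ Suc k - 1)"
      by (simp flip: power_Suc)
    then have N: "real_of_int N * w = 1 / 2"
      by (simp add: N_def w_def width_def power_divide)
    have "real_of_int j * w < real_of_int N * w" using j(1) x N by simp
    then have "j + 1 \<le> N" using \<open>0 < w\<close> by simp
    then have "real_of_int (j + 1) * w \<le> real_of_int N * w"
      using \<open>0 < w\<close> by (intro mult_right_mono) linarith+
    then show ?thesis using N by simp
  qed
  moreover define E where "E = {real_of_int j * w ..< real_of_int (j + 1) * w}"
  moreover have "0 \<le> real_of_int j * w" using \<open>0 < w\<close> \<open>j \<ge> 0\<close> by simp
  ultimately have E: "{0..<1 / 2} \<inter> E = E" "E \<subseteq> {0..}" by auto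
  have "measure lborel E = w"
    using \<open>0 < w\<close> by (simp add: E_def algebra_simps)
  then have "w = (1 / 2) ^ Suc 0 * measure (spike 0) E"
    using E by (simp add: spike_def measure_uniform_on width_0 E_def)
  also have "\<dots> \<le> measure spiked E"
    unfolding spiked_def by (intro measure_mixture_ge components) (simp add: E_def)
  also have "E \<subseteq> mcball_of mixed_space x r"
    using x E cell_eq_iff[of k _ j] by (subst mixed_ball_nonneg[OF _ r]) (auto simp: E_def w_def j_def)
  then have "measure spiked E \<le> measure spiked (mcball_of mixed_space x r)"
    by (intro finite_measure_mono) (auto simp: borel_probs_mixed_spaceD[OF spiked_in])
  finally show ?thesis by (simp add: w_def)
qed

text \<open>
The integrand does not change: the balls about nonnegative points stay the same sets, and those
about negative points are null sets.
\<close>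

lemma corr_integral_spiked_const:
  assumes r: "width (Suc k) \<le> r" "r < width k"
  shows "corr_integral mixed_space spiked A r = corr_integral mixed_space spiked A (width (Suc k))"
proof -
  have w: "width (Suc k) \<le> width (Suc k)" "width (Suc k) < width k"
    by (simp_all add: width_strict_antimono)
  interpret prob_space spiked by (rule borel_probs_mixed_spaceD[OF spiked_in])
  have "measure spiked (mcball_of mixed_space x s) = 0" if "x < 0" "s < 1" for x s
  proof -
    have "measure spiked (mcball_of mixed_space x s) =
        measure spiked (mcball_of mixed_space x s \<inter> {0..<1 / 2})"
      by (simp add: measure_spiked_Int)
    also have "mcball_of mixed_space x s \<inter> {0..<1 / 2} = {}"
      using mixed_ball_neg[OF that] by auto
    finally show ?thesis by simp
  qed
  moreover have "r < 1" using r width_lt_1[of k] by linarith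
  ultimately have "measure spiked (mcball_of mixed_space x r) =
      measure spiked (mcball_of mixed_space x (width (Suc k)))" for x
    using mixed_ball_nonneg[OF _ r, of x] mixed_ball_nonneg[OF _ w, of x] by (cases "0 \<le> x") simp_all
  then show ?thesis by (simp add: corr_integral_def)
qed

lemma corr_integral_spiked_ge:
  assumes A: "A \<in> sets borel" and r: "0 < r" "r < 1 / 2"
  shows "measure spiked A * r ^ 4 \<le> corr_integral mixed_space spiked A r"
proof -
  obtain k where k: "width (Suc k) \<le> r" "r < width k" using ex_width_interval[OF r] .
  have "r ^ 4 \<le> width (Suc k)"
    unfolding width_Suc using k r by (intro power_mono) auto
  then have "measure spiked A * r ^ 4 \<le> width (Suc k) * measure spiked (A \<inter> {0..<1 / 2})"
    using A mult_left_mono[of "r ^ 4" "width (Suc k)" "measure spiked A"]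
    by (simp add: measure_spiked_Int mult.commute)
  also have "\<dots> \<le> corr_integral mixed_space spiked A r"
    using A measure_spiked_ball_ge[OF _ k] by (intro corr_integral_ge spiked_in) auto
  finally show ?thesis .
qed

text \<open>
The innermost cell \<open>{0..<width (Suc k)}\<close> is contained in the ball about each of its points and
carries at least the weight of one component, which is of order \<open>1 / 2 ^ k\<close>. As \<open>4 ^ k\<close> is the
binary logarithm of \<open>1 / width k\<close>, the square of this weight is only logarithmic in the radius.
\<close>

lemma corr_integral_spiked_UNIV_ge:
  assumes r: "0 < r" "r < 1 / 2"
  shows "1 / (16 * log 2 (1 / r)) \<le> corr_integral mixed_space spiked UNIV r"
proof -
  interpret prob_space spiked by (rule borel_probs_mixed_spaceD[OF spiked_in])
  obtain k where k: "width (Suc k) \<le> r" "r < width k" using ex_width_interval[OF r] .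
  define E where "E = {0..<width (Suc k)}"
  define m :: real where "m = (1 / 2) ^ Suc (Suc k)"
  have "measure (spike (Suc k)) E = 1"
    by (simp add: E_def spike_def measure_uniform_on width_nonzero)
  then have mE: "m \<le> measure spiked E"
    using measure_mixture_ge[of spike E "Suc k"] components(1)
    by (simp add: E_def spiked_def m_def)
  have cell0: "cell k x = 0" if "x \<in> E" for x
    using that by (auto simp: E_def cell_eq_iff)
  have ball: "m \<le> measure spiked (mcball_of mixed_space x r)" if x: "x \<in> E" for x
  proof -
    have "E \<subseteq> mcball_of mixed_space x r"
      using x cell0 by (subst mixed_ball_nonneg[OF _ k]) (auto simp: E_def)
    then have "measure spiked E \<le> measure spiked (mcball_of mixed_space x r)"
      by (intro finite_measure_mono) (auto simp: borel_probs_mixed_spaceD[OF spiked_in])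
    then show ?thesis using mE by simp
  qed
  have "4 ^ k = log 2 (1 / width k)"
    by (simp add: width_def power_divide log_nat_power)
  also have "\<dots> \<le> log 2 (1 / r)"
    using r k by (simp add: frac_le)
  finally have "1 / (16 * log 2 (1 / r)) \<le> 1 / (16 * 4 ^ k)"
    by (intro divide_left_mono mult_left_mono mult_pos_pos)
      (auto intro: less_le_trans[of 0 "4 ^ k"])
  also have "\<dots> = m * m"
    by (simp add: m_def power_divide flip: power_mult_distrib)
  also have "\<dots> \<le> m * measure spiked E"
    using mE by (intro mult_left_mono) (auto simp: m_def)
  also have "\<dots> \<le> corr_integral mixed_space spiked UNIV r"
    using ball by (intro corr_integral_ge spiked_in) (auto simp: E_def)
  finally show ?thesis .
qed

lemma corr_quotient_spiked_UNIV:
  "(corr_quotient mixed_space spiked UNIV \<longlongrightarrow> ereal 0) (at_right 0)"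
proof (rule corr_quotient_tendsto[OF _ ln_log_over_ln])
  show "((\<lambda>r. ln 1 / ln r) \<longlongrightarrow> 0) (at_right (0::real))" by simp
  show "\<forall>\<^sub>F r in at_right 0. 0 < 1 / (16 * log 2 (1 / r)) \<and>
      1 / (16 * log 2 (1 / r)) \<le> corr_integral mixed_space spiked UNIV r \<and>
      corr_integral mixed_space spiked UNIV r \<le> 1"
    using eventually_small
    by eventually_elim
      (auto intro!: corr_integral_spiked_UNIV_ge corr_integral_le_1 spiked_in)
qed

text \<open>
The correlation integral of any set \<open>A\<close> takes the same value at \<open>w\<^sup>2\<close> and at \<open>w ^ 4\<close> for
\<open>w = width (Suc k)\<close>, while the logarithms of these radii differ by the factor 2. So a limit
\<open>l\<close> of the quotients satisfies \<open>l = 2 * l\<close>. It is finite because the integral is at least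
a multiple of \<open>r ^ 4\<close>. In particular, removing a neighbourhood of the peak does not produce a
larger exponent; it destroys the limit.
\<close>

lemma corr_quotient_spiked_pinned:
  assumes A: "A \<in> sets borel" and pos: "0 < measure spiked A"
    and lim: "(corr_quotient mixed_space spiked A \<longlongrightarrow> l) (at_right 0)"
  shows "l = 0"
proof -
  define F where "F = corr_integral mixed_space spiked A"
  define c where "c = measure spiked A"
  have F: "0 < F r" "c * r ^ 4 \<le> F r" "F r \<le> 1" if "0 < r" "r < 1 / 2" for r
  proof -
    show "c * r ^ 4 \<le> F r"
      using corr_integral_spiked_ge[OF A that] by (simp add: c_def F_def)
    moreover have "0 < c * r ^ 4" using pos that by (simp add: c_def)
    ultimately show "0 < F r" by linarith
    show "F r \<le> 1"
      unfolding F_def using A by (intro corr_integral_le_1 spiked_in) simp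
  qed
  have q: "corr_quotient mixed_space spiked A r = ereal (ln (F r) / ln r)"
    if "0 < r" "r < 1 / 2" for r
    using F(1)[OF that] by (simp add: corr_quotient_eq F_def)
  have "0 \<le> l"
  proof (rule tendsto_lowerbound[OF lim])
    show "\<forall>\<^sub>F r in at_right 0. 0 \<le> corr_quotient mixed_space spiked A r"
      using eventually_small
      by eventually_elim (use F in \<open>auto simp: q intro!: divide_nonpos_neg\<close>)
  qed simp
  have "l \<le> ereal 4"
  proof (rule tendsto_le[OF _ _ lim])
    show "((\<lambda>r. ereal (ln (c * r ^ 4) / ln r)) \<longlongrightarrow> ereal 4) (at_right 0)"
      using ln_power_over_ln[of c] pos by (simp add: c_def)
    show "\<forall>\<^sub>F r in at_right 0. corr_quotient mixed_space spiked A r \<le> ereal (ln (c * r ^ 4) / ln r)"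
      using eventually_small
    proof eventually_elim
      case (elim r)
      then have "ln (c * r ^ 4) \<le> ln (F r)"
        using F[of r] pos by (auto simp: c_def)
      then show ?case using elim by (simp add: q divide_right_mono_neg)
    qed
  qed simp
  \<comment> \<open>The radii \<open>width (Suc k) ^ 2\<close> and \<open>width (Suc (Suc k))\<close> lie in the same gap between
    consecutive distances.\<close>
  have to0: "filterlim (\<lambda>k. width (Suc k)) (at_right 0) sequentially"
    "filterlim (\<lambda>k. width (Suc k) ^ 2) (at_right 0) sequentially"
    using LIMSEQ_Suc[OF width_tendsto_0] tendsto_power[OF LIMSEQ_Suc[OF width_tendsto_0], of 2]
    by (auto simp: filterlim_at width_nonzero)
  have lim1: "(\<lambda>k. corr_quotient mixed_space spiked A (width (Suc (Suc k)))) \<longlonglongrightarrow> l"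
    using filterlim_compose[OF lim filterlim_compose[OF to0(1) filterlim_Suc]] by simp
  have lim2: "(\<lambda>k. corr_quotient mixed_space spiked A (width (Suc k) ^ 2)) \<longlonglongrightarrow> l"
    using filterlim_compose[OF lim to0(2)] .
  have "corr_quotient mixed_space spiked A (width (Suc k) ^ 2) =
      2 * corr_quotient mixed_space spiked A (width (Suc (Suc k)))" for k
  proof -
    define w where "w = width (Suc k)"
    have w: "0 < w" "w < 1 / 2"
      using width_le_half[of 0] width_strict_antimono[of 0 "Suc k"] by (auto simp: w_def)
    have w2: "w ^ 4 \<le> w ^ 2" "w ^ 2 < w"
      using w power_decreasing[of 2 4 w] by (auto simp: power2_eq_square)
    have "F (w ^ 2) = F (w ^ 4)"
      using corr_integral_spiked_const[of "Suc k" "w ^ 2" A] w2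
      by (simp add: F_def w_def width_Suc[of "Suc k"])
    moreover have "ln (w ^ 4) = 2 * ln (w ^ 2)" using w by (simp add: ln_realpow)
    moreover have "w ^ 2 < 1 / 2" "w ^ 4 < 1 / 2" using w w2 by linarith+
    moreover have "0 < w ^ 4" "0 < w ^ 2" using w by auto
    ultimately show ?thesis
      using w by (simp add: q width_Suc[of "Suc k"] flip: w_def)
  qed
  then have "(\<lambda>k. 2 * corr_quotient mixed_space spiked A (width (Suc (Suc k)))) \<longlonglongrightarrow> l"
    using lim2 by simp
  moreover have "(\<lambda>k. 2 * corr_quotient mixed_space spiked A (width (Suc (Suc k)))) \<longlonglongrightarrow> 2 * l"
    using lim1 by (intro tendsto_cmult_ereal) auto
  ultimately have "l = 2 * l" using LIMSEQ_unique by blast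
  with \<open>0 \<le> l\<close> \<open>l \<le> ereal 4\<close> show ?thesis by (cases l) auto
qed

section \<open>The approximating measures\<close>

text \<open>
Every component left has a density at most \<open>1 / width n\<close>, and balls of the mixed space lie in
Euclidean balls of the same radius.
\<close>

lemma measure_truncated_ball_le:
  assumes r: "0 < r" "r < 1 / 2"
  shows "measure (truncated n) (mcball_of mixed_space x r) \<le> 2 / width n * r"
proof -
  let ?B = "mcball_of mixed_space x r"
  have len: "measure lborel (I \<inter> ?B) \<le> 2 * r" if "I \<in> sets borel" for I
  proof -
    have "measure lborel (I \<inter> ?B) \<le> measure lborel {x - r..x + r}"
      using that mixed_ball_subset[OF r, of x] by (intro measure_mono_fmeasurable) (use r in \<open>auto simp: fmeasurable_def\<close>)
    then show ?thesis using r by simp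
  qed
  have "measure (splice n spike (\<lambda>_. flat_measure) k) ?B \<le> 2 / width n * r" for k
  proof (cases "k < n")
    case True
    have "measure (spike k) ?B \<le> 2 * r / width k"
      using len[of "{0..<width k}"] by (simp add: spike_def measure_uniform_on divide_right_mono)
    also have "\<dots> \<le> 2 * r / width n"
      using r True by (intro divide_left_mono width_antimono mult_pos_pos) auto
    finally show ?thesis using True by (simp add: splice_def)
  next
    case False
    have "measure flat_measure ?B \<le> 2 * r"
      using len[of "{-1..<0}"] by (simp add: flat_measure_def measure_uniform_on)
    also have "\<dots> \<le> 2 * r / width n"
      using r width_lt_1[of n] by (simp add: pos_le_divide_eq mult_left_le less_imp_le)
    finally show ?thesis using False by (simp add: splice_def)
  qed
  then show ?thesis
    unfolding truncated_def by (intro measure_mixture_le spliced) auto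
qed

lemma truncated_ge_flat:
  assumes "A \<in> sets borel"
  shows "(1 / 2) ^ Suc n * measure flat_measure A \<le> measure (truncated n) A"
  using measure_mixture_ge[where c="splice n spike (\<lambda>_. flat_measure)" and k=n, OF spliced(1), of A] assms
  by (simp add: truncated_def splice_def)

lemma measure_flat_ball_ge:
  assumes r: "0 < r" "r < 1 / 2" and x: "x \<in> {-1..<0}"
  shows "r \<le> measure flat_measure (mcball_of mixed_space x r)"
proof -
  obtain a where a: "{a..<a + r} \<subseteq> {-1..<0}" "{a..<a + r} \<subseteq> {x - r..x + r}"
  proof (cases "x < - 1 / 2")
    case True
    then show ?thesis using r x by (intro that[of x]) auto
  next
    case False
    then show ?thesis using r x by (intro that[of "x - r"]) auto
  qed
  have "{a..<a + r} \<subseteq> {-1..<0} \<inter> mcball_of mixed_space x r"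
  proof
    fix y assume y: "y \<in> {a..<a + r}"
    then have "y \<in> {-1..<0}" "\<bar>x - y\<bar> \<le> r" using a by (auto dest!: subsetD[of _ _ y])
    then show "y \<in> {-1..<0} \<inter> mcball_of mixed_space x r"
      using x by (auto simp: mixed_dist_def)
  qed
  then have "measure lborel {a..<a + r} \<le> measure lborel ({-1..<0} \<inter> mcball_of mixed_space x r)"
    by (intro measure_mono_fmeasurable fmeasurable_Int_fmeasurable) (auto simp: fmeasurable_def)
  then show ?thesis using r by (simp add: flat_measure_def measure_uniform_on)
qed

lemma measure_Int_ge:
  assumes \<nu>: "\<nu> \<in> borel_probs mixed_space" and "A \<in> sets borel" "S \<in> sets borel"
    and "1 - \<delta> \<le> measure \<nu> A" "2 * \<delta> \<le> measure \<nu> S"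
  shows "\<delta> \<le> measure \<nu> (A \<inter> S)"
proof -
  interpret prob_space \<nu> by (rule borel_probs_mixed_spaceD[OF \<nu>])
  have "measure \<nu> (A \<union> S) = measure \<nu> A + measure \<nu> S - measure \<nu> (A \<inter> S)"
    using assms by (intro measure_Un3) (auto simp: borel_probs_mixed_spaceD[OF \<nu>] fmeasurable_eq_sets)
  then show ?thesis using assms prob_le_1[of "A \<union> S"] by linarith
qed

text \<open>
The upper bound is the bounded density. The lower bound comes from the part of \<open>A\<close> in the Euclidean
half-line, on which the flat component has balls of mass at least \<open>r\<close>; the assumption on \<open>A\<close>
leaves at least half of the weight of that component.
\<close>

lemma corr_quotient_truncated:
  assumes A: "A \<in> sets borel" and big: "1 - (1 / 2) ^ (n + 2) \<le> measure (truncated n) A"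
  shows "(corr_quotient mixed_space (truncated n) A \<longlongrightarrow> ereal 1) (at_right 0)"
proof -
  define m :: real where "m = (1 / 2) ^ Suc n"
  have "measure flat_measure {-1..<0} = 1" by (simp add: flat_measure_def measure_uniform_on)
  then have "m \<le> measure (truncated n) {-1..<0}"
    using truncated_ge_flat[of "{-1..<0}" n] by (simp add: m_def)
  then have mA: "m / 2 \<le> measure (truncated n) (A \<inter> {-1..<0})"
    using A big by (intro measure_Int_ge truncated_in) (auto simp: m_def)
  have "0 < m" by (simp add: m_def)
  show ?thesis
  proof (rule corr_quotient_tendsto)
    show "((\<lambda>r. ln (m * (m / 2) * r) / ln r) \<longlongrightarrow> 1) (at_right 0)"
      using \<open>0 < m\<close> by (intro ln_linear_over_ln) simp
    show "((\<lambda>r. ln (2 / width n * r) / ln r) \<longlongrightarrow> 1) (at_right 0)"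
      by (intro ln_linear_over_ln) simp
    show "\<forall>\<^sub>F r in at_right 0. 0 < m * (m / 2) * r \<and>
        m * (m / 2) * r \<le> corr_integral mixed_space (truncated n) A r \<and>
        corr_integral mixed_space (truncated n) A r \<le> 2 / width n * r"
      using eventually_small
    proof eventually_elim
      case (elim r)
      have "m * r \<le> measure (truncated n) (mcball_of mixed_space x r)" if "x \<in> {-1..<0}" for x
      proof -
        have "m * r \<le> m * measure flat_measure (mcball_of mixed_space x r)"
          using elim that \<open>0 < m\<close> by (intro mult_left_mono measure_flat_ball_ge) auto
        also have "\<dots> \<le> measure (truncated n) (mcball_of mixed_space x r)"
          unfolding m_def by (intro truncated_ge_flat) simp
        finally show ?thesis .
      qed
      then have "m * r * measure (truncated n) (A \<inter> {-1..<0})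
          \<le> corr_integral mixed_space (truncated n) A r"
        using A by (intro corr_integral_ge truncated_in) auto
      moreover have "m * r * (m / 2) \<le> m * r * measure (truncated n) (A \<inter> {-1..<0})"
        using mA \<open>0 < m\<close> elim by (intro mult_left_mono) auto
      moreover have "corr_integral mixed_space (truncated n) A r \<le> 2 / width n * r"
        using A elim measure_truncated_ball_le by (intro corr_integral_le truncated_in) auto
      moreover have "m * (m / 2) * r = m * r * (m / 2)" "0 < m * r * (m / 2)"
        using elim \<open>0 < m\<close> by simp_all
      ultimately show ?case by linarith
    qed
  qed
qed

text \<open>
A set that misses less than the mass of the atom contains the atom, and then the correlation
integral is bounded below by a constant.
\<close>

lemma corr_quotient_with_atom:
  assumes A: "A \<in> sets borel" and big: "1 - (1 / 2) ^ (n + 2) \<le> measure (with_atom n) A"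
  shows "(corr_quotient mixed_space (with_atom n) A \<longlongrightarrow> ereal 0) (at_right 0)"
proof -
  interpret prob_space "with_atom n" by (rule borel_probs_mixed_spaceD[OF with_atom_in])
  define m :: real where "m = (1 / 2) ^ Suc n"
  have "0 < m" by (simp add: m_def)
  have "measure atom {0} = 1" by (simp add: atom_def measure_return)
  then have m0: "m \<le> measure (with_atom n) {0}"
    using measure_mixture_ge[where c="splice n (\<lambda>_. flat_measure) (\<lambda>_. atom)" and k=n, OF spliced(2), of "{0}"]
    by (simp add: with_atom_def splice_def m_def)
  then have "m / 2 \<le> measure (with_atom n) (A \<inter> {0})"
    using A big by (intro measure_Int_ge with_atom_in) (auto simp: m_def)
  then have "0 \<in> A" using \<open>0 < m\<close> by (cases "0 \<in> A") auto
  show ?thesis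
  proof (rule corr_quotient_tendsto[OF _ ln_const_over_ln[of "m * m"] ln_const_over_ln[of 1]])
    show "\<forall>\<^sub>F r in at_right 0. 0 < m * m \<and>
        m * m \<le> corr_integral mixed_space (with_atom n) A r \<and>
        corr_integral mixed_space (with_atom n) A r \<le> 1"
      using eventually_small
    proof eventually_elim
      case (elim r)
      have "measure (with_atom n) {0} \<le> measure (with_atom n) (mcball_of mixed_space 0 r)"
        using elim
        by (intro finite_measure_mono) (auto simp: borel_probs_mixed_spaceD[OF with_atom_in] mixed_dist_def cell_dist_def)
      then have "m * measure (with_atom n) {0} \<le> corr_integral mixed_space (with_atom n) A r"
        using A m0 \<open>0 \<in> A\<close> by (intro corr_integral_ge with_atom_in) auto
      moreover have "m * m \<le> m * measure (with_atom n) {0}"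
        using m0 \<open>0 < m\<close> by simp
      moreover have "corr_integral mixed_space (with_atom n) A r \<le> 1"
        using A by (intro corr_integral_le_1 with_atom_in) simp
      moreover have "0 < m * m" using \<open>0 < m\<close> by simp
      ultimately show ?case by linarith
    qed
  qed
qed

section \<open>Dimensions and failure of semi-continuity\<close>

lemma dims_spiked:
  "spiked \<in> dim_C_domain mixed_space" "dim_C mixed_space spiked = 0"
  "spiked \<in> dim_MC_domain mixed_space" "dim_MC mixed_space spiked = 0"
proof -
  have full: "(corr_quotient mixed_space spiked (mspace mixed_space) \<longlongrightarrow> 0) (at_right 0)"
    using corr_quotient_spiked_UNIV by (simp add: zero_ereal_def)
  have pinned: "l' = 0" if "A \<in> sets (borel_of_metric mixed_space)" "1 - 1 / 2 \<le> measure spiked A"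
    "(corr_quotient mixed_space spiked A \<longlongrightarrow> l') (at_right 0)" for A l'
    using that by (intro corr_quotient_spiked_pinned[of A]) auto
  show "spiked \<in> dim_C_domain mixed_space" "dim_C mixed_space spiked = 0"
    "spiked \<in> dim_MC_domain mixed_space" "dim_MC mixed_space spiked = 0"
    by (rule dims_eqI[OF spiked_in full pinned], assumption+, simp)+
qed

lemma dims_eq_of_big_sets:
  assumes \<nu>: "\<nu> \<in> borel_probs X" and "0 < \<delta>"
    and lim: "\<And>A. A \<in> sets (borel_of_metric X) \<Longrightarrow> 1 - \<delta> \<le> measure \<nu> A \<Longrightarrow>
        (corr_quotient X \<nu> A \<longlongrightarrow> l) (at_right 0)"
  shows "\<nu> \<in> dim_C_domain X" "dim_C X \<nu> = l" "\<nu> \<in> dim_MC_domain X" "dim_MC X \<nu> = l"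
proof -
  interpret prob_space \<nu> using borel_probsD[OF \<nu>] by simp
  have full: "(corr_quotient X \<nu> (mspace X) \<longlongrightarrow> l) (at_right 0)"
    using \<open>0 < \<delta>\<close> prob_space sets.top[of \<nu>] borel_probsD[OF \<nu>] by (intro lim) auto
  have pinned: "l' = l" if "A \<in> sets (borel_of_metric X)" "1 - \<delta> \<le> measure \<nu> A"
    "(corr_quotient X \<nu> A \<longlongrightarrow> l') (at_right 0)" for A l'
    using tendsto_unique[OF _ that(3) lim[OF that(1,2)]] by simp
  show "\<nu> \<in> dim_C_domain X" "dim_C X \<nu> = l" "\<nu> \<in> dim_MC_domain X" "dim_MC X \<nu> = l"
    by (rule dims_eqI[OF \<nu> full pinned \<open>0 < \<delta>\<close>], assumption+)+
qed

lemma dims_truncated: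
  "truncated n \<in> dim_C_domain mixed_space" "dim_C mixed_space (truncated n) = 1"
  "truncated n \<in> dim_MC_domain mixed_space" "dim_MC mixed_space (truncated n) = 1"
  using dims_eq_of_big_sets[OF truncated_in, of "(1 / 2) ^ (n + 2)" n "ereal 1"] corr_quotient_truncated
  by (auto simp: one_ereal_def)

lemma dims_with_atom:
  "with_atom n \<in> dim_C_domain mixed_space" "dim_C mixed_space (with_atom n) = 0"
  "with_atom n \<in> dim_MC_domain mixed_space" "dim_MC mixed_space (with_atom n) = 0"
  using dims_eq_of_big_sets[OF with_atom_in, of "(1 / 2) ^ (n + 2)" n "ereal 0"] corr_quotient_with_atom
  by (auto simp: zero_ereal_def)

lemma truncated_tendsto_spiked: "(\<lambda>n. tv_dist mixed_space (truncated n) spiked) \<longlonglongrightarrow> 0"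
  unfolding truncated_def spiked_def by (intro tv_dist_mixture_splice components)

lemma with_atom_tendsto_truncated_0:
  "(\<lambda>n. tv_dist mixed_space (with_atom n) (truncated 0)) \<longlonglongrightarrow> 0"
proof -
  have "truncated 0 = mixture (\<lambda>_. flat_measure)" by (simp add: truncated_def splice_def)
  then show ?thesis
    unfolding with_atom_def by (simp add: tv_dist_mixture_splice components)
qed

lemma not_upper:
  assumes "\<And>n. truncated n \<in> P" "spiked \<in> P" "\<And>n. D (truncated n) = 1" "D spiked = 0"
  shows "\<not> tv_upper_semicontinuous mixed_space P D"
proof
  assume "tv_upper_semicontinuous mixed_space P D"
  then have "limsup (\<lambda>n. D (truncated n)) \<le> D spiked"
    unfolding tv_upper_semicontinuous_def using assms(1,2) truncated_tendsto_spiked by blast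
  then show False using assms(3,4) by (simp add: Limsup_const)
qed

lemma not_lower:
  assumes "\<And>n. with_atom n \<in> P" "truncated 0 \<in> P" "\<And>n. D (with_atom n) = 0" "D (truncated 0) = 1"
  shows "\<not> tv_lower_semicontinuous mixed_space P D"
proof
  assume "tv_lower_semicontinuous mixed_space P D"
  then have "D (truncated 0) \<le> liminf (\<lambda>n. D (with_atom n))"
    unfolding tv_lower_semicontinuous_def using assms(1,2) with_atom_tendsto_truncated_0 by blast
  then show False using assms(3,4) by (simp add: Liminf_const)
qed

theorem theorem3p2:
  shows "(\<exists>X::real metric. \<not> tv_upper_semicontinuous X (dim_C_domain X) (dim_C X)) \<and>
         (\<exists>X::real metric. \<not> tv_lower_semicontinuous X (dim_C_domain X) (dim_C X)) \<and>
         (\<exists>X::real metric. \<not> tv_upper_semicontinuous X (dim_MC_domain X) (dim_MC X)) \<and>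
         (\<exists>X::real metric. \<not> tv_lower_semicontinuous X (dim_MC_domain X) (dim_MC X))"
  by (intro conjI exI[of _ mixed_space] not_upper not_lower dims_spiked dims_truncated dims_with_atom)

end
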